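(* Let $\mathfrak{R}=(R;<,0,1,+,(\lambda\cdot)_{\lambda\in D})$ be an ordered vector space over an ordered division ring $D$. Let $V$ be a composite space indexed by a finite set $I$ with $V[i]$ a copy of $R^{m_i}$ for each $i\in I$, and let $\mathcal{X}=(X_b)_{b\in R^n}$ be a simple family in $V$. Then there is $s\in\mathbb{N}$ such that $\pi_{\mathcal{X}}(t)=\Theta(t^s)$.
   Context: A composite space indexed by a finite set $I$ is a disjoint union $V=\bigsqcup_{i\in I}V[i]$; for $A\subseteq V$, $A[i]=A\cap V[i]$. A family in $V$ parameterized by $Y$ is $\mathcal{X}=(X_b)_{b\in Y}$ with $X_b\subseteq V$; $\mathcal{X}[i]=(X_b[i])_{b\in Y}$. Its shatter function is $\pi_{\mathcal{X}}(t)=\max\{|\{X_b\cap A : b\in Y\}| : A\subseteq V,|A|=t\}$. The family $\mathcal{X}$ (parameterized by $R^n$) is simple if for every $i\in I$ there are linear polynomials $f_{i,1},\dots,f_{i,m_i}$ in $n$ variables with coefficients in $D$ (of the form $y\mapsto \lambda_1y_1+\dots+\lambda_ny_n$, $\lambda_j\in D$) such that either (a) $X_b[i]=\{(f_{i,1}(b),\dots,f_{i,m_i}(b))\}$ for all $b\in R^n$ (a family of points), or (b) $X_b[i]=\{(f_{i,1}(b),\dots,f_{i,m_i-1}(b),u): u\ge f_{i,m_i}(b)\}$ for all $b\in R^n$ (a family of half-lines). *)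

theory Defs
  imports Complex_Main "HOL-Library.Landau_Symbols"
begin

text \<open>
  The division ring is not assumed commutative, so the library locales for modules and vector
  spaces, which require a commutative ring of scalars, do not apply. The sort
  \<open>{division_ring, linordered_ring_strict}\<close> is that of (linearly) ordered division rings.
  The distinguished element \<open>one\<close> interprets the constant symbol 1 of the structure and makes the
  space nontrivial.
\<close>

locale ordered_vector_space =
  fixes scale :: "'d::{division_ring, linordered_ring_strict} \<Rightarrow> 'r::linordered_ab_group_add \<Rightarrow> 'r"
    and one :: 'r
  assumes scale_right_distrib: "scale a (x + y) = scale a x + scale a y"
    and scale_left_distrib: "scale (a + b) x = scale a x + scale b x"
    and scale_scale: "scale a (scale b x) = scale (a * b) x"
    and scale_one: "scale 1 x = x"
    and scale_pos: "0 < a \<Longrightarrow> 0 < x \<Longrightarrow> 0 < scale a x"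
    and one_pos: "0 < one"

definition tuples :: "nat \<Rightarrow> 'r list set" where
  "tuples n = {v. length v = n}"

text \<open>
  A composite space is a disjoint union, encoded as \<open>Sigma I W\<close>; its part of index \<open>i\<close> is a tagged
  copy of \<open>W i\<close>. Accordingly \<open>part A i\<close> is \<open>A[i]\<close> with the tags removed.
\<close>

definition part :: "('i \<times> 'a) set \<Rightarrow> 'i \<Rightarrow> 'a set" where
  "part A i = {x. (i, x) \<in> A}"

text \<open>
  A family in \<open>V\<close> parameterized by \<open>Y\<close> is a function \<open>X\<close> of which only the values on \<open>Y\<close> matter.
\<close>

definition family_in :: "'v set \<Rightarrow> 'b set \<Rightarrow> ('b \<Rightarrow> 'v set) \<Rightarrow> bool" where
  "family_in V Y X \<longleftrightarrow> (\<forall>b\<in>Y. X b \<subseteq> V)"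

text \<open>
  The maximum is meaningful when \<open>V\<close> has a subset of size \<open>t\<close>: the set is then nonempty, and bounded
  by \<open>2 ^ t\<close>. The condition \<open>finite A\<close> is needed because infinite sets have \<open>card\<close> zero.
\<close>

definition shatter_function :: "'v set \<Rightarrow> 'b set \<Rightarrow> ('b \<Rightarrow> 'v set) \<Rightarrow> nat \<Rightarrow> nat" where
  "shatter_function V Y X t =
     Max {card {X b \<inter> A |b. b \<in> Y} |A. A \<subseteq> V \<and> finite A \<and> card A = t}"

definition linear_polynomial ::
  "('d \<Rightarrow> 'r::comm_monoid_add \<Rightarrow> 'r) \<Rightarrow> nat \<Rightarrow> ('r list \<Rightarrow> 'r) \<Rightarrow> bool" where
  "linear_polynomial scale n f \<longleftrightarrow>
     (\<exists>c :: nat \<Rightarrow> 'd. \<forall>y\<in>tuples n. f y = (\<Sum>j<n. scale (c j) (y ! j)))"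

text \<open>
  In the following two definitions \<open>P\<close> is the family of the \<open>i\<close>-th parts, a family in \<open>tuples m\<close>
  parameterized by \<open>tuples n\<close>. The polynomials are indexed from 0, so the last one is \<open>f (m - 1)\<close>.
\<close>

definition family_of_points ::
  "nat \<Rightarrow> nat \<Rightarrow> (nat \<Rightarrow> 'r list \<Rightarrow> 'r) \<Rightarrow> ('r list \<Rightarrow> 'r list set) \<Rightarrow> bool" where
  "family_of_points n m f P \<longleftrightarrow>
     (\<forall>b\<in>tuples n. P b = {map (\<lambda>k. f k b) [0..<m]})"

definition family_of_half_lines ::
  "nat \<Rightarrow> nat \<Rightarrow> (nat \<Rightarrow> 'r::ord list \<Rightarrow> 'r) \<Rightarrow> ('r list \<Rightarrow> 'r list set) \<Rightarrow> bool" where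
  "family_of_half_lines n m f P \<longleftrightarrow>
     m \<ge> 1 \<and> (\<forall>b\<in>tuples n. P b = {map (\<lambda>k. f k b) [0..<m - 1] @ [u] |u. u \<ge> f (m - 1) b})"

definition simple_family ::
  "('d \<Rightarrow> 'r::linordered_ab_group_add \<Rightarrow> 'r) \<Rightarrow> 'i set \<Rightarrow> ('i \<Rightarrow> nat) \<Rightarrow> nat \<Rightarrow>
   ('r list \<Rightarrow> ('i \<times> 'r list) set) \<Rightarrow> bool" where
  "simple_family scale I m n X \<longleftrightarrow>
     (\<forall>i\<in>I. \<exists>f :: nat \<Rightarrow> 'r list \<Rightarrow> 'r.
        (\<forall>k<m i. linear_polynomial scale n (f k)) \<and>
        (family_of_points n (m i) f (\<lambda>b. part (X b) i) \<or>
         family_of_half_lines n (m i) f (\<lambda>b. part (X b) i)))"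

end

theory Submission
  imports Defs "HOL-Library.FuncSet"
begin

text \<open>
  Choose for every index either the kernel of its base forms or the common kernel of its base
  forms and its height form. The exponent \<open>s\<close> is the largest size of a set of indices for which
  some such choice is irredundant: no kernel contains the intersection of the others. A vector
  \<open>v\<^sub>j\<close> witnessing this for each \<open>j\<close> yields about \<open>t ^ s\<close> traces, those of the combinations
  \<open>\<Sum> c\<^sub>j v\<^sub>j\<close> with natural numbers \<open>c\<^sub>j\<close>. Conversely, a parameter is moved to a minimal face of the
  closed cell that its trace defines; an irredundant subset of the equations of this face already
  determines the trace up to finitely many choices, the number of which does not depend on \<open>t\<close>.
\<close>

section \<open>Scalar multiplication over a possibly noncommutative ordered division ring\<close>

context ordered_vector_space
begin

lemma scale_zero_right [simp]: "scale a 0 = 0"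
  using scale_right_distrib[of a 0 0] by simp

lemma scale_zero_left [simp]: "scale 0 x = 0"
  using scale_left_distrib[of 0 0 x] by simp

lemma scale_minus_right: "scale a (- x) = - scale a x"
  using scale_right_distrib[of a x "- x"] by (simp add: eq_neg_iff_add_eq_0 add.commute)

lemma scale_minus_left: "scale (- a) x = - scale a x"
  using scale_left_distrib[of a "- a" x] by (simp add: eq_neg_iff_add_eq_0 add.commute)

lemma scale_diff_right: "scale a (x - y) = scale a x - scale a y"
  using scale_right_distrib[of a x "- y"] by (simp add: scale_minus_right)

lemma scale_diff_left: "scale (a - b) x = scale a x - scale b x"
  using scale_left_distrib[of a "- b" x] by (simp add: scale_minus_left)

lemma scale_sum_right: "scale a (sum f A) = (\<Sum>x\<in>A. scale a (f x))"
  by (induction A rule: infinite_finite_induct) (auto simp: scale_right_distrib)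

lemma scale_sum_left: "scale (sum f A) x = (\<Sum>k\<in>A. scale (f k) x)"
  by (induction A rule: infinite_finite_induct) (auto simp: scale_left_distrib)

lemma scale_eq_0_iff: "scale a x = 0 \<longleftrightarrow> a = 0 \<or> x = 0"
proof (cases "a = 0")
  case False
  then have "x = scale (inverse a) (scale a x)"
    by (simp add: scale_scale scale_one)
  then show ?thesis
    by (metis scale_zero_right scale_zero_left)
qed auto

lemma of_nat_strict_mono: "strict_mono (of_nat :: nat \<Rightarrow> 'd)"
proof -
  have "0 \<le> (1::'d) * 1"
    by (rule zero_le_square)
  then have "0 < (1::'d)"
    by (simp add: order_less_le)
  then show ?thesis
    by (simp add: strict_mono_Suc_iff)
qed

lemma scale_of_nat_cancel:
  assumes "scale (of_nat k) x = scale (of_nat l) x" "x \<noteq> 0"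
  shows "k = l"
proof -
  have "scale (of_nat k - of_nat l) x = 0"
    using assms(1) by (simp add: scale_diff_left)
  then have "(of_nat k :: 'd) = of_nat l"
    using assms(2) by (simp add: scale_eq_0_iff)
  then show ?thesis
    using strict_mono_eq[OF of_nat_strict_mono] by blast
qed

lemma scale_pos_iff:
  assumes "0 < a"
  shows "0 < scale a x \<longleftrightarrow> 0 < x"
proof
  assume *: "0 < scale a x"
  show "0 < x"
  proof (rule ccontr)
    assume "\<not> 0 < x"
    then have "x = 0 \<or> 0 < - x" by auto
    then show False
      using * scale_pos[OF assms, of "- x"] by (auto simp: scale_minus_right)
  qed
qed (use assms scale_pos in blast)

text \<open>Read \<open>d\<close> as the slope of a motion that starts at 0: a positive value passed
  by time \<open>c\<close> is reached exactly at the earlier time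
  \<open>scale (inverse d) y\<close>. The slope is positive, since otherwise
  \<open>scale d c\<close> would not be.\<close>

lemma scale_between:
  assumes "0 < y" "y < scale d c" "0 < c"
  obtains c' where "0 < c'" "c' < c" "scale d c' = y" "d \<noteq> 0"
proof -
  have d: "0 < d"
  proof (rule ccontr)
    assume "\<not> 0 < d"
    then have "d = 0 \<or> 0 < - d" by auto
    then show False
      using assms scale_pos[of "- d" c] by (auto simp: scale_minus_left)
  qed
  define c' where "c' = scale (inverse d) y"
  have eq: "scale d c' = y"
    using d by (simp add: c'_def scale_scale scale_one)
  have "0 < c'"
    using scale_pos_iff[OF d, of c'] eq assms by simp
  moreover have "0 < c - c'"
    using scale_pos_iff[OF d, of "c - c'"] eq assms by (simp add: scale_diff_right)
  ultimately show thesis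
    using that[of c'] eq d by simp
qed

section \<open>Linear forms and dual vectors\<close>

definition eval :: "nat \<Rightarrow> (nat \<Rightarrow> 'd) \<Rightarrow> (nat \<Rightarrow> 'r) \<Rightarrow> 'r" where
  "eval n c b = (\<Sum>j<n. scale (c j) (b j))"

text \<open>The order of the factors matters: forms are combined by left multiples and vectors by
  right multiples, and the pairing respects both.\<close>

definition dot :: "nat \<Rightarrow> (nat \<Rightarrow> 'd) \<Rightarrow> (nat \<Rightarrow> 'd) \<Rightarrow> 'd" where
  "dot n c v = (\<Sum>j<n. c j * v j)"

lemma eval_add: "eval n c (\<lambda>j. x j + y j) = eval n c x + eval n c y"
  by (simp add: eval_def scale_right_distrib sum.distrib)

lemma eval_diff: "eval n c (\<lambda>j. x j - y j) = eval n c x - eval n c y"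
  by (simp add: eval_def scale_diff_right sum_subtractf)

lemma eval_combination:
  "eval n c (\<lambda>j. \<Sum>k\<in>J. scale (of_nat (z k)) (v k j)) = (\<Sum>k\<in>J. scale (of_nat (z k)) (eval n c (v k)))"
proof -
  have "eval n c (\<lambda>j. \<Sum>k\<in>J. scale (of_nat (z k)) (v k j))
      = (\<Sum>j<n. \<Sum>k\<in>J. scale (of_nat (z k)) (scale (c j) (v k j)))"
    by (simp add: eval_def scale_sum_right scale_scale mult_of_nat_commute)
  also have "\<dots> = (\<Sum>k\<in>J. scale (of_nat (z k)) (eval n c (v k)))"
    by (subst sum.swap) (simp add: eval_def scale_sum_right)
  finally show ?thesis .
qed

lemma eval_scale_left: "eval n c (\<lambda>j. scale (v j) x) = scale (dot n c v) x"
  by (simp add: eval_def dot_def scale_scale scale_sum_left)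

lemma eval_coeff_diff: "eval n (\<lambda>j. c j - r * e j) x = eval n c x - scale r (eval n e x)"
  by (simp add: eval_def scale_diff_left sum_subtractf scale_sum_right scale_scale)

lemma dot_coeff_diff: "dot n (\<lambda>j. c j - r * e j) v = dot n c v - r * dot n e v"
  by (simp add: dot_def algebra_simps sum_subtractf sum_distrib_left)

lemma dot_diff: "dot n c (\<lambda>j. v j - w j * r) = dot n c v - dot n c w * r"
  by (simp add: dot_def algebra_simps sum_subtractf sum_distrib_right)

text \<open>A separating vector \<open>h\<close> over R is replaced by one over D. Motion along
  \<open>h\<close> itself can only be scaled by elements of D and so may miss a prescribed element
  of R; motion by \<open>scale (v j) x\<close> has a free parameter \<open>x\<close> in R and
  changes the value of \<open>d\<close> by exactly \<open>x\<close>. The induction is Gaussian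
  elimination: a form independent of \<open>L\<close> is removed with the help of a vector dual to
  it.\<close>

lemma exists_dual_vector:
  assumes "finite L" "\<And>c. c \<in> L \<Longrightarrow> eval n c h = 0" "eval n d h \<noteq> 0"
  shows "\<exists>v. (\<forall>c\<in>L. dot n c v = 0) \<and> dot n d v = 1"
  using assms
proof (induction L arbitrary: d h rule: finite_induct)
  case empty
  have "\<exists>j<n. d j \<noteq> 0"
  proof (rule ccontr)
    assume "\<not> ?thesis"
    then have "eval n d h = 0" by (simp add: eval_def)
    then show False using empty by simp
  qed
  then obtain j where j: "j < n" "d j \<noteq> 0" by blast
  have "dot n d (\<lambda>i. if i = j then inverse (d j) else 0) = (\<Sum>i<n. if i = j then 1 else 0)"
    unfolding dot_def using j by (intro sum.cong) auto
  then show ?case using j by auto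
next
  case (insert e L)
  show ?case
  proof (cases "\<exists>h'. (\<forall>c\<in>L. eval n c h' = 0) \<and> eval n e h' \<noteq> 0")
    case True
    then obtain w where w: "\<And>c. c \<in> L \<Longrightarrow> dot n c w = 0" "dot n e w = 1"
      using insert.IH by metis
    \<comment> \<open>This coefficient makes \<open>d'\<close> pair to 0 with \<open>w\<close>, so a
      right multiple of \<open>w\<close> can later be subtracted to make \<open>e\<close> vanish
      without changing the value of \<open>d'\<close>.\<close>
    define d' where "d' = (\<lambda>j. d j - dot n d w * e j)"
    have "eval n d' h \<noteq> 0"
      using insert.prems by (simp add: d'_def eval_coeff_diff)
    from insert.IH[OF insert.prems(1)[OF insertI2] this]
    obtain v where v: "\<And>c. c \<in> L \<Longrightarrow> dot n c v = 0" "dot n d' v = 1"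
      by blast
    have "dot n d v - dot n d w * dot n e v = 1"
      using v(2) by (simp add: d'_def dot_coeff_diff)
    then show ?thesis
      using v(1) w by (intro exI[of _ "\<lambda>j. v j - w j * dot n e v"]) (auto simp: dot_diff)
  next
    case False
    from insert.IH[OF insert.prems(1)[OF insertI2] insert.prems(2)]
    obtain v where v: "\<And>c. c \<in> L \<Longrightarrow> dot n c v = 0" "dot n d v = 1"
      by blast
    \<comment> \<open>The nonzero element \<open>one\<close> carries vectors over D to vectors over
      R, to which the assumption of this case applies.\<close>
    have "\<forall>c\<in>L. eval n c (\<lambda>j. scale (v j) one) = 0"
      using v(1) by (simp add: eval_scale_left)
    then have "eval n e (\<lambda>j. scale (v j) one) = 0"
      using False by blast
    then have "dot n e v = 0"
      using one_pos by (auto simp: eval_scale_left scale_eq_0_iff)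
    then show ?thesis using v by auto
  qed
qed

end

section \<open>Half-line systems and irredundant sets of indices\<close>

text \<open>
  A point family is treated as a half-line family whose height form is zero: its points have
  height 0, and their base is the whole point.
\<close>

locale half_line_system = ordered_vector_space scale one
  for scale :: "'d::{division_ring, linordered_ring_strict} \<Rightarrow> 'r::linordered_ab_group_add \<Rightarrow> 'r"
    and one :: 'r +
  fixes n :: nat and I :: "'i set" and M :: "'i \<Rightarrow> nat"
    and a :: "'i \<Rightarrow> nat \<Rightarrow> nat \<Rightarrow> 'd" and g :: "'i \<Rightarrow> nat \<Rightarrow> 'd"
    and W :: "'i \<Rightarrow> 'a set" and base :: "'i \<Rightarrow> 'a \<Rightarrow> nat \<Rightarrow> 'r" and height :: "'i \<Rightarrow> 'a \<Rightarrow> 'r"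
  assumes finite_index: "finite I"
    and realizable: "i \<in> I \<Longrightarrow> \<exists>x\<in>W i. (\<forall>k<M i. base i x k = y k) \<and> height i x = eval n (g i) b"
begin

abbreviation gv :: "'i \<Rightarrow> (nat \<Rightarrow> 'r) \<Rightarrow> 'r" where
  "gv i b \<equiv> eval n (g i) b"

definition over :: "'i \<Rightarrow> 'a \<Rightarrow> (nat \<Rightarrow> 'r) \<Rightarrow> bool" where
  "over i x b \<longleftrightarrow> (\<forall>k<M i. eval n (a i k) b = base i x k)"

definition hit :: "'i \<Rightarrow> 'a \<Rightarrow> (nat \<Rightarrow> 'r) \<Rightarrow> bool" where
  "hit i x b \<longleftrightarrow> over i x b \<and> gv i b \<le> height i x"

definition trace :: "('i \<times> 'a) set \<Rightarrow> (nat \<Rightarrow> 'r) \<Rightarrow> ('i \<times> 'a) set" where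
  "trace A b = {(i, x) \<in> A. hit i x b}"

text \<open>One set \<open>T\<close> encodes the choice of a kernel for every index: it marks those
  whose height form takes part.\<close>

definition vanish :: "'i set \<Rightarrow> 'i set \<Rightarrow> (nat \<Rightarrow> 'r) \<Rightarrow> bool" where
  "vanish J T h \<longleftrightarrow> (\<forall>i\<in>J. (\<forall>k<M i. eval n (a i k) h = 0) \<and> (i \<in> T \<longrightarrow> gv i h = 0))"

definition irredundant :: "'i set \<Rightarrow> 'i set \<Rightarrow> bool" where
  "irredundant J T \<longleftrightarrow> (\<forall>j\<in>J. \<exists>h. vanish (J - {j}) T h \<and> \<not> vanish {j} T h)"

text \<open>Dropping a redundant index leaves the common kernel unchanged, and in a finite set this
  can be repeated until no index is redundant.\<close>

lemma irredundant_subset: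
  assumes "finite J"
  shows "\<exists>J'\<subseteq>J. irredundant J' T \<and> (\<forall>h. vanish J' T h \<longrightarrow> vanish J T h)"
  using assms
proof (induction J rule: finite_psubset_induct)
  case (psubset J)
  show ?case
  proof (cases "irredundant J T")
    case False
    then obtain j where j: "j \<in> J" "\<And>h. vanish (J - {j}) T h \<Longrightarrow> vanish {j} T h"
      unfolding irredundant_def by blast
    then have "vanish (J - {j}) T h \<Longrightarrow> vanish J T h" for h
      unfolding vanish_def by blast
    moreover obtain J' where "J' \<subseteq> J - {j}" "irredundant J' T"
        "\<forall>h. vanish J' T h \<longrightarrow> vanish (J - {j}) T h"
      using psubset.IH[of "J - {j}"] j(1) by blast
    ultimately show ?thesis by blast
  qed blast
qed

section \<open>Lower bound for the number of traces\<close>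

text \<open>At an index of \<open>J\<close> the vectors of all other indices vanish on the chosen
  forms, so these see only the coefficient of that index. Placing \<open>q\<close> points at each
  index, one for each coefficient below \<open>q\<close>, lets the trace reveal all
  coefficients.\<close>

lemma trace_lower_bound:
  assumes J: "J \<subseteq> I" and irr: "irredundant J T"
  shows "\<exists>A \<subseteq> Sigma I W. finite A \<and> card A \<le> q * card J \<and> q ^ card J \<le> card (range (trace A))"
proof -
  have finJ: "finite J"
    using J finite_index finite_subset by blast
  obtain v where v: "\<And>j. j \<in> J \<Longrightarrow> vanish (J - {j}) T (v j) \<and> \<not> vanish {j} T (v j)"
    using irr unfolding irredundant_def by metis
  define b where "b = (\<lambda>(z::'i \<Rightarrow> nat) l. \<Sum>k\<in>J. scale (of_nat (z k)) (v k l))"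
  define C where "C = PiE J (\<lambda>_. {..<q})"
  have finC: "finite C"
    using finJ by (auto simp: C_def intro: finite_PiE)
  have eval_b: "eval n e (b z) = scale (of_nat (z i)) (eval n e (v i))"
    if "i \<in> J" "\<And>k. k \<in> J - {i} \<Longrightarrow> eval n e (v k) = 0" for e z i
  proof -
    have "eval n e (b z) = (\<Sum>k\<in>J. scale (of_nat (z k)) (eval n e (v k)))"
      by (simp add: b_def eval_combination)
    also have "\<dots> = scale (of_nat (z i)) (eval n e (v i)) + (\<Sum>k\<in>J - {i}. scale (of_nat (z k)) (eval n e (v k)))"
      using finJ that(1) by (rule sum.remove)
    also have "(\<Sum>k\<in>J - {i}. scale (of_nat (z k)) (eval n e (v k))) = 0"
      using that(2) by (intro sum.neutral) simp
    finally show ?thesis by simp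
  qed
  have base_b: "eval n (a i k) (b z) = scale (of_nat (z i)) (eval n (a i k) (v i))"
    if "i \<in> J" "k < M i" for i k z
    using that v by (intro eval_b) (auto simp: vanish_def)
  \<comment> \<open>The trace identifies \<open>z i\<close> if every combination hits its own point
    and mutual hits force equality. Single hits would not suffice, since half-lines over the same
    base are nested.\<close>
  have choose: "\<exists>x. (\<forall>l. x l \<in> W i) \<and> (\<forall>z\<in>C. hit i (x (z i)) (b z)) \<and>
      (\<forall>z z'. hit i (x (z i)) (b z') \<and> hit i (x (z' i)) (b z) \<longrightarrow> z i = z' i)" if i: "i \<in> J" for i
  proof (cases "\<exists>k<M i. eval n (a i k) (v i) \<noteq> 0")
    case True
    then obtain k where k: "k < M i" "eval n (a i k) (v i) \<noteq> 0" by blast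
    \<comment> \<open>Here the base separates the points. If \<open>i\<close> is outside
      \<open>T\<close>, the height form may depend on all coefficients; its maximum over the grid
      \<open>C\<close> is a height at which no hit can fail.\<close>
    have "\<exists>z0. \<forall>z\<in>C. gv i (b z) \<le> gv i (b z0)"
    proof (cases "C = {}")
      case False
      have "Max ((\<lambda>z. gv i (b z)) ` C) \<in> (\<lambda>z. gv i (b z)) ` C"
        using finC False by (intro Max_in) auto
      then obtain z0 where z0: "Max ((\<lambda>z. gv i (b z)) ` C) = gv i (b z0)"
        by (rule imageE)
      have "\<forall>z\<in>C. gv i (b z) \<le> gv i (b z0)"
        using finC by (simp flip: z0)
      then show ?thesis by blast
    qed simp
    then obtain z0 where z0: "\<And>z. z \<in> C \<Longrightarrow> gv i (b z) \<le> gv i (b z0)" by blast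
    have "\<forall>l. \<exists>x. x \<in> W i \<and> (\<forall>k<M i. base i x k = scale (of_nat l) (eval n (a i k) (v i))) \<and> height i x = gv i (b z0)"
    proof
      fix l
      show "\<exists>x. x \<in> W i \<and> (\<forall>k<M i. base i x k = scale (of_nat l) (eval n (a i k) (v i))) \<and> height i x = gv i (b z0)"
        using realizable[of i "\<lambda>k. scale (of_nat l) (eval n (a i k) (v i))" "b z0"] i J by blast
    qed
    from choice[OF this] obtain x where x: "\<And>l. x l \<in> W i"
        "\<And>l k. k < M i \<Longrightarrow> base i (x l) k = scale (of_nat l) (eval n (a i k) (v i))"
        "\<And>l. height i (x l) = gv i (b z0)"
      by blast
    have inj: "z i = z' i" if "hit i (x (z i)) (b z')" for z z'
    proof (rule scale_of_nat_cancel[OF _ k(2)])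
      show "scale (of_nat (z i)) (eval n (a i k) (v i)) = scale (of_nat (z' i)) (eval n (a i k) (v i))"
        using that k(1) i by (simp add: hit_def over_def x base_b)
    qed
    have "hit i (x (z i)) (b z)" if "z \<in> C" for z
      using i x(2,3) z0[OF that] by (simp add: hit_def over_def base_b)
    then show ?thesis
      using x(1) inj by (intro exI[of _ x]) blast
  next
    case False
    then have iT: "i \<in> T" and nz: "gv i (v i) \<noteq> 0"
      using v[OF i] by (auto simp: vanish_def)
    have gb: "gv i (b z) = scale (of_nat (z i)) (gv i (v i))" for z
      using i v iT by (intro eval_b) (auto simp: vanish_def)
    \<comment> \<open>All bases agree, so the heights must separate. The height form sees only the
      coefficient at \<open>i\<close>, so the constant function with value \<open>l\<close>
      represents every \<open>z\<close> with \<open>z i = l\<close>.\<close>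
    have "\<forall>l. \<exists>x. x \<in> W i \<and> (\<forall>k<M i. base i x k = 0) \<and> height i x = gv i (b (\<lambda>_. l))"
    proof
      fix l
      show "\<exists>x. x \<in> W i \<and> (\<forall>k<M i. base i x k = 0) \<and> height i x = gv i (b (\<lambda>_. l))"
        using realizable[of i "\<lambda>k. 0" "b (\<lambda>_. l)"] i J by blast
    qed
    from choice[OF this] obtain x where x: "\<And>l. x l \<in> W i"
        "\<And>l k. k < M i \<Longrightarrow> base i (x l) k = 0"
        "\<And>l. height i (x l) = gv i (b (\<lambda>_. l))"
      by blast
    have inj: "z i = z' i" if "hit i (x (z i)) (b z')" "hit i (x (z' i)) (b z)" for z z'
      using that by (intro scale_of_nat_cancel[OF _ nz] order.antisym) (simp_all add: hit_def x gb)
    have "eval n (a i k) (b z) = 0" if "k < M i" for k z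
      using False i that by (simp add: base_b)
    then have "hit i (x (z i)) (b z)" for z
      using x(2,3) by (simp add: hit_def over_def gb)
    then show ?thesis
      using x(1) inj by (intro exI[of _ x]) blast
  qed
  from bchoice[OF ballI[OF choose]]
  obtain x where "\<forall>i\<in>J. (\<forall>l. x i l \<in> W i) \<and> (\<forall>z\<in>C. hit i (x i (z i)) (b z)) \<and>
      (\<forall>z z'. hit i (x i (z i)) (b z') \<and> hit i (x i (z' i)) (b z) \<longrightarrow> z i = z' i)"
    by (rule exE)
  then have x: "x i l \<in> W i" "z \<in> C \<Longrightarrow> hit i (x i (z i)) (b z)"
      "hit i (x i (z i)) (b z') \<Longrightarrow> hit i (x i (z' i)) (b z) \<Longrightarrow> z i = z' i" if "i \<in> J" for i l z z'
    using that by simp_all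
  define A where "A = (\<lambda>(i, l). (i, x i l)) ` (J \<times> {..<q})"
  have "inj_on (\<lambda>z. trace A (b z)) C"
  proof (rule inj_onI)
    fix z z' assume z: "z \<in> C" "z' \<in> C" and eq: "trace A (b z) = trace A (b z')"
    have mem: "(i, x i (y i)) \<in> trace A (b y)" if "i \<in> J" "y \<in> C" for i y
    proof -
      have "y i < q" using that by (auto simp: C_def)
      then show ?thesis
        using x(2)[OF that] that by (auto simp: trace_def A_def)
    qed
    have "z i = z' i" if i: "i \<in> J" for i
    proof (rule x(3)[OF i])
      show "hit i (x i (z i)) (b z')"
        using mem[OF i z(1)] unfolding eq by (simp add: trace_def)
      show "hit i (x i (z' i)) (b z)"
        using mem[OF i z(2)] unfolding eq[symmetric] by (simp add: trace_def)
    qed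
    then show "z = z'"
      using z by (auto simp: C_def intro: PiE_ext)
  qed
  then have "card ((\<lambda>z. trace A (b z)) ` C) = q ^ card J"
    using finJ by (simp add: card_image C_def card_PiE)
  moreover have finA: "finite A"
    using finJ by (simp add: A_def)
  moreover have "finite (range (trace A))"
    using finA by (auto simp: trace_def intro: rev_finite_subset[of "Pow A"])
  then have "card ((\<lambda>z. trace A (b z)) ` C) \<le> card (range (trace A))"
    by (intro card_mono) auto
  moreover have "card A \<le> card (J \<times> {..<q})"
    unfolding A_def using finJ by (intro card_image_le) simp
  moreover have "A \<subseteq> Sigma I W"
    using J x(1) by (auto simp: A_def)
  ultimately show ?thesis
    by (intro exI[of _ A]) (simp add: card_cartesian_product mult.commute)
qed

section \<open>Closed cells and their faces\<close>

definition supp :: "('i \<times> 'a) set \<Rightarrow> (nat \<Rightarrow> 'r) \<Rightarrow> 'i set" where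
  "supp A b = fst ` trace A b"

text \<open>The strict inequality of a missed element is weakened, so a point of the closed cell may
  lie at the height of an element that \<open>b\<close> misses. Indices outside the support impose
  no condition, as their part of the trace is empty.\<close>

definition closure_of_cell :: "('i \<times> 'a) set \<Rightarrow> (nat \<Rightarrow> 'r) \<Rightarrow> (nat \<Rightarrow> 'r) \<Rightarrow> bool" where
  "closure_of_cell A b b' \<longleftrightarrow>
     (\<forall>i\<in>supp A b. \<forall>k<M i. eval n (a i k) b' = eval n (a i k) b) \<and>
     (\<forall>(i, x)\<in>A. i \<in> supp A b \<and> over i x b \<longrightarrow>
        (if gv i b \<le> height i x then gv i b' \<le> height i x else height i x \<le> gv i b'))"

text \<open>These indices select the height equations of the face through \<open>b'\<close>.\<close>

definition tight :: "('i \<times> 'a) set \<Rightarrow> (nat \<Rightarrow> 'r) \<Rightarrow> (nat \<Rightarrow> 'r) \<Rightarrow> 'i set" where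
  "tight A b b' = {i \<in> supp A b. \<exists>x. (i, x) \<in> A \<and> over i x b \<and> height i x = gv i b'}"

text \<open>
  From a point of the closed cell one moves along a line on which all equations keep holding,
  up to the first height that is reached.
\<close>

lemma more_tight:
  assumes A: "finite A" "A \<subseteq> Sigma I W"
    and cl: "closure_of_cell A b b'"
    and h: "vanish (supp A b) (tight A b b') h" and i: "i \<in> supp A b" "gv i h \<noteq> 0"
  shows "\<exists>b''. closure_of_cell A b b'' \<and> tight A b b' \<subset> tight A b b''"
proof -
  let ?J = "supp A b" and ?T = "tight A b b'"
  have JI: "?J \<subseteq> I"
    using A(2) by (auto simp: supp_def trace_def)
  have finJ: "finite ?J"
    using JI finite_index finite_subset by blast
  have TJ: "?T \<subseteq> ?J" by (auto simp: tight_def)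
  \<comment> \<open>These forms have to stay constant during the motion. They vanish at
    \<open>h\<close> while \<open>g i\<close> does not, which yields a direction over D with the
    same property.\<close>
  define L where "L = (\<Union>j\<in>?J. a j ` {..<M j}) \<union> g ` ?T"
  have "finite L"
    using finJ finite_subset[OF TJ] by (auto simp: L_def)
  moreover have "eval n c h = 0" if "c \<in> L" for c
    using that h TJ by (auto simp: L_def vanish_def)
  ultimately obtain v where v: "\<And>c. c \<in> L \<Longrightarrow> dot n c v = 0" "dot n (g i) v = 1"
    using exists_dual_vector[of L n h "g i"] i(2) by blast
  obtain x where x: "(i, x) \<in> A" "over i x b"
    using i(1) by (auto simp: supp_def trace_def hit_def)
  have iT: "i \<notin> ?T"
    using h i by (auto simp: vanish_def)
  then have "height i x \<noteq> gv i b'"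
    using x i(1) by (auto simp: tight_def)
  \<comment> \<open>The sign turns the motion so that the height form of \<open>i\<close> approaches
    the height of \<open>x\<close>, which makes \<open>D\<close> nonempty.\<close>
  define w where "w = (if height i x - gv i b' > 0 then v else (\<lambda>j. v j * (- 1)))"
  have dot_w: "dot n c w = (if height i x - gv i b' > 0 then dot n c v else - dot n c v)" for c
    by (simp add: w_def dot_def sum_negf)
  define d where "d = (\<lambda>j. dot n (g j) w)"
  \<comment> \<open>These are the times at which a nonconstant height form reaches the height of an
    element of \<open>A\<close>. Each element contributes at most one, so there is a first
    time.\<close>
  define D where "D = {c. 0 < c \<and> (\<exists>(j, y)\<in>A. j \<in> ?J \<and> over j y b \<and> d j \<noteq> 0 \<and> scale (d j) c = height j y - gv j b')}"
  have "D \<subseteq> (\<lambda>(j, y). scale (inverse (d j)) (height j y - gv j b')) ` A"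
  proof
    fix c assume "c \<in> D"
    then obtain j y where jy: "(j, y) \<in> A" "d j \<noteq> 0" "scale (d j) c = height j y - gv j b'"
      by (auto simp: D_def)
    have "c = scale (inverse (d j)) (scale (d j) c)"
      using jy(2) by (simp add: scale_scale scale_one)
    then show "c \<in> (\<lambda>(j, y). scale (inverse (d j)) (height j y - gv j b')) ` A"
      using jy by force
  qed
  then have finD: "finite D"
    using A(1) finite_surj by blast
  have "(if height i x - gv i b' > 0 then height i x - gv i b' else gv i b' - height i x) \<in> D"
    using x i(1) v(2) \<open>height i x \<noteq> gv i b'\<close>
    by (auto simp: D_def d_def dot_w scale_minus_left scale_one intro!: bexI[of _ "(i, x)"])
  then have D0: "D \<noteq> {}" by blast
  define c where "c = Min D"
  have cD: "c \<in> D"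
    unfolding c_def using finD D0 by (rule Min_in)
  then have c0: "0 < c" by (simp add: D_def)
  have c_least: "\<not> c' < c" if "c' \<in> D" for c'
    using that finD by (simp add: c_def not_less)
  define b'' where "b'' = (\<lambda>j. b' j + scale (w j) c)"
  have eval_b'': "eval n e b'' = eval n e b' + scale (dot n e w) c" for e
    by (simp add: b''_def eval_add eval_scale_left)
  have base_b'': "eval n (a j k) b'' = eval n (a j k) b" if "j \<in> ?J" "k < M j" for j k
  proof -
    have "dot n (a j k) w = 0"
      using v(1)[of "a j k"] that by (auto simp: dot_w L_def)
    then show ?thesis
      using cl that by (simp add: eval_b'' closure_of_cell_def)
  qed
  have gT: "gv j b'' = gv j b'" if "j \<in> ?T" for j
  proof -
    have "dot n (g j) w = 0"
      using v(1)[of "g j"] that by (auto simp: dot_w L_def)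
    then show ?thesis by (simp add: eval_b'')
  qed
  \<comment> \<open>A comparison reversed at time \<open>c\<close> would have passed through
    equality at an earlier time in \<open>D\<close>.\<close>
  have up: "gv j b'' \<le> height j y"
    if jy: "(j, y) \<in> A" "j \<in> ?J" "over j y b" "gv j b' < height j y" for j y
  proof (rule ccontr)
    assume "\<not> gv j b'' \<le> height j y"
    then have "height j y - gv j b' < scale (d j) c"
      by (simp add: eval_b'' d_def less_diff_eq diff_less_eq add.commute)
    then obtain c' where "0 < c'" "c' < c" "scale (d j) c' = height j y - gv j b'" "d j \<noteq> 0"
      using scale_between[of "height j y - gv j b'" "d j" c] jy c0 by auto
    then show False
      using c_least[of c'] jy by (auto simp: D_def)
  qed
  have down: "height j y \<le> gv j b''"
    if jy: "(j, y) \<in> A" "j \<in> ?J" "over j y b" "height j y < gv j b'" for j y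
  proof (rule ccontr)
    assume "\<not> height j y \<le> gv j b''"
    then have "gv j b' + scale (d j) c < height j y"
      by (simp add: eval_b'' d_def)
    then have "gv j b' - height j y < scale (- d j) c"
      by (simp add: scale_minus_left algebra_simps less_diff_eq)
    then obtain c' where "0 < c'" "c' < c" "scale (- d j) c' = gv j b' - height j y" "- d j \<noteq> 0"
      using scale_between[of "gv j b' - height j y" "- d j" c] jy c0 by auto
    then show False
      using c_least[of c'] jy by (force simp: D_def scale_minus_left algebra_simps)
  qed
  have eq: "height j y = gv j b''"
    if jy: "(j, y) \<in> A" "j \<in> ?J" "over j y b" "height j y = gv j b'" for j y
  proof -
    have "j \<in> ?T" using jy by (auto simp: tight_def)
    then show ?thesis using gT jy by simp
  qed
  have cell: "if gv j b \<le> height j y then gv j b'' \<le> height j y else height j y \<le> gv j b''"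
    if j: "(j, y) \<in> A" "j \<in> ?J" "over j y b" for j y
  proof -
    have "if gv j b \<le> height j y then gv j b' \<le> height j y else height j y \<le> gv j b'"
      using cl j by (auto simp: closure_of_cell_def)
    then show ?thesis
      using up[OF j] down[OF j] eq[OF j] by (auto simp: le_less split: if_splits)
  qed
  have "closure_of_cell A b b''"
    unfolding closure_of_cell_def
  proof (rule conjI)
    show "\<forall>(i, x)\<in>A. i \<in> ?J \<and> over i x b \<longrightarrow>
        (if gv i b \<le> height i x then gv i b'' \<le> height i x else height i x \<le> gv i b'')"
      by (clarify, rule cell)
  qed (use base_b'' in simp)
  moreover have "?T \<subseteq> tight A b b''"
  proof
    fix j assume "j \<in> ?T"
    then show "j \<in> tight A b b''"
      using gT[of j] by (auto simp: tight_def)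
  qed
  moreover obtain j y where jy: "(j, y) \<in> A" "j \<in> ?J" "over j y b" "d j \<noteq> 0"
      "scale (d j) c = height j y - gv j b'"
    using cD by (auto simp: D_def)
  have "j \<in> tight A b b''"
    using jy by (auto simp: tight_def eval_b'' d_def)
  \<comment> \<open>Height forms of tight indices have slope 0, whereas the one reached at time
    \<open>c\<close> has nonzero slope.\<close>
  moreover have "j \<notin> ?T"
    using v(1)[of "g j"] jy(4) by (auto simp: L_def d_def dot_w split: if_splits)
  ultimately show ?thesis by blast
qed

text \<open>A point of the closed cell with the most tight indices works: by
  \<open>more_tight\<close>, a height form of the support that still varied on the common kernel
  would allow a further one.\<close>

lemma exists_minimal_face:
  assumes A: "finite A" "A \<subseteq> Sigma I W"
  shows "\<exists>b'. closure_of_cell A b b' \<and>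
    (\<forall>h. vanish (supp A b) (tight A b b') h \<longrightarrow> (\<forall>i\<in>supp A b. gv i h = 0))"
proof -
  have finI: "tight A b b' \<subseteq> I" for b'
    using A(2) by (auto simp: tight_def)
  have "closure_of_cell A b b"
    by (auto simp: closure_of_cell_def)
  moreover have "\<forall>b'. closure_of_cell A b b' \<longrightarrow> card (tight A b b') < Suc (card I)"
    using finI finite_index by (simp add: card_mono less_Suc_eq_le)
  ultimately obtain b' where b': "closure_of_cell A b b'"
      "\<And>b''. closure_of_cell A b b'' \<Longrightarrow> card (tight A b b'') \<le> card (tight A b b')"
    using ex_has_greatest_nat[of "closure_of_cell A b" b "\<lambda>b'. card (tight A b b')" "Suc (card I)"]
    by blast
  have "gv i h = 0" if "vanish (supp A b) (tight A b b') h" "i \<in> supp A b" for h i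
  proof (rule ccontr)
    assume "gv i h \<noteq> 0"
    from more_tight[OF A b'(1) that this]
    obtain b'' where "closure_of_cell A b b''" "tight A b b' \<subset> tight A b b''"
      by blast
    then show False
      using b'(2) psubset_card_mono[of "tight A b b''" "tight A b b'"]
        finite_subset[OF finI finite_index] by (meson leD)
  qed
  then show ?thesis using b'(1) by blast
qed

section \<open>Upper bound for the number of traces\<close>

text \<open>
  A trace is recovered from a point on a minimal face of its cell, up to one bit per index that
  decides about the element of \<open>A\<close> lying on the face. That point matters only modulo the common
  kernel of all equations, and hence is described by elements of \<open>A\<close> over an irredundant set of
  indices.
\<close>

lemma trace_upper_bound:
  assumes A: "finite A" "A \<subseteq> Sigma I W" "A \<noteq> {}"
    and s: "\<And>J T. J \<subseteq> I \<Longrightarrow> irredundant J T \<Longrightarrow> card J \<le> s"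
  shows "card (range (trace A)) \<le> 8 ^ card I * card A ^ s"
proof -
  have "\<forall>b. \<exists>b'. closure_of_cell A b b' \<and>
      (\<forall>h. vanish (supp A b) (tight A b b') h \<longrightarrow> (\<forall>i\<in>supp A b. gv i h = 0))"
    using exists_minimal_face[OF A(1,2)] by (rule allI)
  from choice[OF this] obtain f where f: "\<And>b. closure_of_cell A b (f b)"
      "\<And>b h i. vanish (supp A b) (tight A b (f b)) h \<Longrightarrow> i \<in> supp A b \<Longrightarrow> gv i h = 0"
    by blast
  define T where "T = (\<lambda>b. tight A b (f b))"
  \<comment> \<open>The choice depends only on \<open>J\<close> and \<open>T\<close>, so parameters
    with equal support and equal tight set use the same irredundant subset.\<close>
  define J0 where "J0 = (\<lambda>J T. SOME J'. J' \<subseteq> J \<and> irredundant J' T \<and> (\<forall>h. vanish J' T h \<longrightarrow> vanish J T h))"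
  have J0: "J0 J T \<subseteq> J \<and> irredundant (J0 J T) T \<and> (\<forall>h. vanish (J0 J T) T h \<longrightarrow> vanish J T h)"
    if "J \<subseteq> I" for J T
    using someI_ex[OF irredundant_subset[of J T]] finite_subset[OF that finite_index]
    unfolding J0_def by simp
  have suppI: "supp A b \<subseteq> I" for b
    using A(2) by (auto simp: supp_def trace_def)
  have TI: "T b \<subseteq> I" for b
    using suppI[of b] by (auto simp: T_def tight_def)
  have ex: "\<exists>x. (i, x) \<in> A \<and> over i x b \<and> (i \<in> T b \<longrightarrow> height i x = gv i (f b))" if "i \<in> supp A b" for i b
  proof (cases "i \<in> T b")
    case True
    then show ?thesis by (auto simp: T_def tight_def)
  next
    case False
    then show ?thesis using that by (auto simp: supp_def trace_def hit_def)
  qed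
  \<comment> \<open>The element \<open>x b i\<close> records the base values of the face point
    \<open>f b\<close> at \<open>i\<close> and, at a tight index, also its height value.\<close>
  define x where "x = (\<lambda>b i. SOME x. (i, x) \<in> A \<and> over i x b \<and> (i \<in> T b \<longrightarrow> height i x = gv i (f b)))"
  have x: "(i, x b i) \<in> A \<and> over i (x b i) b \<and> (i \<in> T b \<longrightarrow> height i (x b i) = gv i (f b))"
    if "i \<in> supp A b" for i b
    using someI_ex[OF ex[OF that]] unfolding x_def .
  \<comment> \<open>This is the bit for an element lying on the face: its height is
    \<open>gv i (f b)\<close>, so it is hit exactly if \<open>i\<close> belongs to
    \<open>F b\<close>.\<close>
  define F where "F = (\<lambda>b. {i \<in> supp A b. gv i b \<le> gv i (f b)})"
  define code where "code = (\<lambda>b. ((supp A b, T b, F b), restrict (x b) (J0 (supp A b) (T b))))"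
  have trace_code: "trace A b \<subseteq> trace A c" if eq: "code b = code c" for b c
  proof
    fix p assume p: "p \<in> trace A b"
    obtain i y where iy: "p = (i, y)" by fastforce
    have S: "supp A b = supp A c" "T b = T c" "F b = F c"
      using eq by (auto simp: code_def)
    let ?J = "supp A c" and ?T = "T c" and ?K = "J0 (supp A c) (T c)"
    have K: "?K \<subseteq> ?J" "\<And>h. vanish ?K ?T h \<Longrightarrow> vanish ?J ?T h"
      using J0[OF suppI] by auto
    have xeq: "x b j = x c j" if "j \<in> ?K" for j
      using eq that S by (auto simp: code_def dest: fun_cong[of _ _ j])
    \<comment> \<open>Equal codes put the difference of the two face points into the kernel over the
      irredundant subset, hence into the kernel over the whole support.\<close>
    define h where "h = (\<lambda>j. f b j - f c j)"
    have fbase: "eval n (a j k) (f b) = eval n (a j k) b" if "j \<in> supp A b" "k < M j" for b j k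
      using f(1)[of b] that by (auto simp: closure_of_cell_def)
    have "vanish ?K ?T h"
      unfolding vanish_def
    proof (intro ballI conjI allI impI)
      fix j k assume j: "j \<in> ?K" "k < M j"
      then have "eval n (a j k) b = eval n (a j k) c"
        using x[of j b] x[of j c] S K xeq by (auto simp: over_def)
      then show "eval n (a j k) h = 0"
        using fbase[of j b k] fbase[of j c k] j K S by (auto simp: h_def eval_diff)
    next
      fix j assume "j \<in> ?K" "j \<in> ?T"
      then show "gv j h = 0"
        using x[of j b] x[of j c] S K xeq by (auto simp: h_def eval_diff)
    qed
    then have vJ: "vanish ?J ?T h" by (rule K)
    have i: "i \<in> ?J" "i \<in> supp A b"
      using p iy S by (force simp: supp_def)+
    have mem: "(i, y) \<in> A" "over i y b" "gv i b \<le> height i y"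
      using p iy by (auto simp: trace_def hit_def)
    \<comment> \<open>Minimality of the face makes the height form vanish on this kernel even if
      \<open>i\<close> is not tight.\<close>
    have g: "gv i (f b) = gv i (f c)"
      using f(2)[of c h i] vJ i by (simp add: T_def h_def eval_diff)
    have overc: "over i y c"
      unfolding over_def
    proof (intro allI impI)
      fix k assume k: "k < M i"
      then have "eval n (a i k) h = 0"
        using vJ i by (auto simp: vanish_def)
      then show "eval n (a i k) c = base i y k"
        using mem(2) k fbase i by (simp add: h_def eval_diff over_def)
    qed
    \<comment> \<open>The two face points have the same height value at \<open>i\<close>. If it lies
      strictly below \<open>y\<close>, the closed cell of \<open>c\<close> shows that
      \<open>c\<close> hits \<open>y\<close>; if it equals the height of \<open>y\<close>, the bit
      in \<open>F\<close> decides.\<close>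
    have "gv i (f b) \<le> height i y"
      using f(1)[of b] mem i by (fastforce simp: closure_of_cell_def)
    moreover have "gv i c \<le> height i y" if "gv i (f c) < height i y"
    proof (rule ccontr)
      assume "\<not> gv i c \<le> height i y"
      then have "height i y \<le> gv i (f c)"
        using f(1)[of c] mem(1) i overc by (auto simp: closure_of_cell_def)
      then show False using that by simp
    qed
    moreover have "gv i c \<le> height i y" if "gv i (f c) = height i y"
    proof -
      have "i \<in> F b" using that g mem i by (simp add: F_def)
      then have "i \<in> F c" unfolding S(3) .
      then show ?thesis using that by (simp add: F_def)
    qed
    ultimately have "gv i c \<le> height i y"
      using g by (auto simp: le_less)
    then show "p \<in> trace A c"
      using iy mem overc by (simp add: trace_def hit_def)
  qed
  \<comment> \<open>Three subsets of \<open>I\<close> account for the factor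
    \<open>8 ^ card I\<close>.\<close>
  define Q where "Q = Pow I \<times> Pow I \<times> Pow I"
  define E where "E = (\<lambda>(J, T, F::'i set). PiE (J0 J T) (\<lambda>i. part A i))"
  have card_part: "card (part A i) \<le> card A" and fin_part: "finite (part A i)" for i
  proof -
    have *: "inj_on (Pair i) (part A i)" "Pair i ` part A i \<subseteq> A"
      by (auto simp: part_def inj_on_def)
    then show "card (part A i) \<le> card A" "finite (part A i)"
      using card_inj_on_le[OF * A(1)] inj_on_finite[OF * A(1)] by blast+
  qed
  have finQ: "finite Q" and cardQ: "card Q = 8 ^ card I"
    using finite_index by (simp_all add: Q_def card_cartesian_product card_Pow flip: power_mult_distrib)
  have E: "finite (E r)" "card (E r) \<le> card A ^ s" if r: "r \<in> Q" for r
  proof -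
    obtain J T F where [simp]: "r = (J, T, F)" and J: "J \<subseteq> I"
      using r by (auto simp: Q_def)
    have K: "J0 J T \<subseteq> I" "irredundant (J0 J T) T"
      using J0[OF J] J by blast+
    have finK: "finite (J0 J T)"
      using K(1) finite_index finite_subset by blast
    then show "finite (E r)"
      using fin_part by (auto simp: E_def intro: finite_PiE)
    have "card (E r) = (\<Prod>i\<in>J0 J T. card (part A i))"
      using finK by (simp add: E_def card_PiE)
    also have "\<dots> \<le> (\<Prod>i\<in>J0 J T. card A)"
      by (intro prod_mono) (simp add: card_part)
    also have "\<dots> \<le> card A ^ s"
      using s[OF K] A by (simp add: power_increasing card_gt_0_iff Suc_leI)
    finally show "card (E r) \<le> card A ^ s" .
  qed
  have codes: "range code \<subseteq> Sigma Q E"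
  proof (rule image_subsetI)
    fix b
    have "J0 (supp A b) (T b) \<subseteq> supp A b"
      using J0[OF suppI] by blast
    moreover have "F b \<subseteq> I"
      using suppI[of b] by (auto simp: F_def)
    ultimately show "code b \<in> Sigma Q E"
      using suppI[of b] TI[of b] x by (auto simp: code_def Q_def E_def part_def)
  qed
  have finSig: "finite (Sigma Q E)"
    using finQ E(1) by (rule finite_SigmaI)
  have "range (trace A) = (\<lambda>r. trace A (inv code r)) ` range code"
  proof -
    have "trace A (inv code (code b)) = trace A b" for b
      using trace_code f_inv_into_f[of "code b" code UNIV] by (intro equalityI) auto
    then show ?thesis by (auto simp: image_image)
  qed
  then have "card (range (trace A)) \<le> card (range code)"
    using finite_subset[OF codes finSig] by (metis card_image_le)
  also have "\<dots> \<le> card (Sigma Q E)"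
    using codes finSig by (rule card_mono[rotated])
  also have "\<dots> = (\<Sum>r\<in>Q. card (E r))"
    using finQ E(1) by (intro card_SigmaI) auto
  also have "\<dots> \<le> of_nat (card Q) * card A ^ s"
    using E(2) by (intro sum_bounded_above)
  finally show ?thesis by (simp add: cardQ)
qed

lemma exists_trace_exponent:
  "\<exists>s. (\<forall>A. finite A \<longrightarrow> A \<subseteq> Sigma I W \<longrightarrow> A \<noteq> {} \<longrightarrow> card (range (trace A)) \<le> 8 ^ card I * card A ^ s) \<and>
       (\<forall>q. \<exists>A \<subseteq> Sigma I W. finite A \<and> card A \<le> q * s \<and> q ^ s \<le> card (range (trace A)))"
proof -
  let ?P = "\<lambda>k. \<exists>J T. J \<subseteq> I \<and> irredundant J T \<and> card J = k"
  have P0: "?P 0"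
    by (intro exI[of _ "{}"]) (simp add: irredundant_def)
  have bound: "k \<le> card I" if "?P k" for k
    using that card_mono[OF finite_index] by auto
  define s where "s = (GREATEST k. ?P k)"
  have "?P s"
    unfolding s_def using P0 bound by (rule GreatestI_nat)
  then obtain J T where J: "J \<subseteq> I" "irredundant J T" "card J = s" by blast
  have "card J' \<le> s" if "J' \<subseteq> I" "irredundant J' T'" for J' T'
    unfolding s_def using that bound by (intro Greatest_le_nat[of ?P _ "card I"]) blast+
  then show ?thesis
    using trace_upper_bound trace_lower_bound[OF J(1,2), unfolded J(3)] by (intro exI[of _ s]) blast
qed

end

section \<open>Shatter functions on infinite sets\<close>

text \<open>Infinity of \<open>V\<close> provides a subset of size \<open>t\<close>, so that
  \<open>Max\<close> is taken over a nonempty set.\<close>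

lemma shatter_function_le:
  assumes "infinite V" and "\<And>A. A \<subseteq> V \<Longrightarrow> finite A \<Longrightarrow> card A = t \<Longrightarrow> card {X b \<inter> A |b. b \<in> Y} \<le> u"
  shows "shatter_function V Y X t \<le> u"
proof -
  let ?S = "{card {X b \<inter> A |b. b \<in> Y} |A. A \<subseteq> V \<and> finite A \<and> card A = t}"
  have "?S \<subseteq> {..u}"
    using assms(2) by auto
  then have "finite ?S"
    using finite_subset by blast
  moreover obtain A where "finite A" "card A = t" "A \<subseteq> V"
    using infinite_arbitrarily_large[OF assms(1)] by blast
  then have "?S \<noteq> {}" by blast
  ultimately show ?thesis
    unfolding shatter_function_def using assms(2) by (subst Max_le_iff) auto
qed

text \<open>A smaller set can be padded to size \<open>t\<close> inside \<open>V\<close>, and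
  intersecting with \<open>A0\<close> maps the traces on the padded set onto those on
  \<open>A0\<close>.\<close>

lemma le_shatter_function:
  assumes V: "infinite V" and A0: "A0 \<subseteq> V" "finite A0" "card A0 \<le> t"
  shows "card {X b \<inter> A0 |b. b \<in> Y} \<le> shatter_function V Y X t"
proof -
  let ?S = "{card {X b \<inter> A |b. b \<in> Y} |A. A \<subseteq> V \<and> finite A \<and> card A = t}"
  have fin_traces: "finite {X b \<inter> A |b. b \<in> Y}" and card_traces: "card {X b \<inter> A |b. b \<in> Y} \<le> 2 ^ card A"
    if "finite A" for A
  proof -
    have sub: "{X b \<inter> A |b. b \<in> Y} \<subseteq> Pow A" by blast
    show "finite {X b \<inter> A |b. b \<in> Y}"
      using sub that by (simp add: finite_subset)
    show "card {X b \<inter> A |b. b \<in> Y} \<le> 2 ^ card A"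
      using card_mono[OF _ sub] that by (simp add: card_Pow)
  qed
  have "?S \<subseteq> {..2 ^ t}"
    using card_traces by auto
  then have fin: "finite ?S"
    using finite_subset by blast
  have "infinite (V - A0)"
    using V A0(2) by simp
  then obtain B where B: "finite B" "card B = t - card A0" "B \<subseteq> V - A0"
    using infinite_arbitrarily_large by metis
  define A where "A = A0 \<union> B"
  have "card A = t"
    unfolding A_def using B A0 by (subst card_Un_disjoint) auto
  then have A: "A \<subseteq> V" "finite A" "card A = t"
    using B A0 by (auto simp: A_def)
  have "{X b \<inter> A0 |b. b \<in> Y} = (\<lambda>Z. Z \<inter> A0) ` {X b \<inter> A |b. b \<in> Y}"
    by (auto simp: A_def image_iff)
  then have "card {X b \<inter> A0 |b. b \<in> Y} \<le> card {X b \<inter> A |b. b \<in> Y}"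
    using card_image_le[OF fin_traces[OF A(2)]] by simp
  also have "\<dots> \<le> shatter_function V Y X t"
    unfolding shatter_function_def using fin A by (intro Max_ge) auto
  finally show ?thesis .
qed

section \<open>From counting bounds to asymptotic growth\<close>

lemma bigtheta_power_nat:
  fixes f :: "nat \<Rightarrow> nat"
  assumes upper: "\<And>t. t > 0 \<Longrightarrow> f t \<le> C * t ^ s"
    and lower: "\<And>q t. q * s \<le> t \<Longrightarrow> q ^ s \<le> f t"
  shows "(\<lambda>t. real (f t)) \<in> \<Theta>(\<lambda>t. real t ^ s)"
proof (rule bigthetaI)
  show "(\<lambda>t. real (f t)) \<in> O(\<lambda>t. real t ^ s)"
  \<comment> \<open>The added 1 keeps the constant positive if \<open>C = 0\<close>.\<close>
  proof (rule landau_o.bigI[of "real C + 1"])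
    show "\<forall>\<^sub>F t in sequentially. norm (real (f t)) \<le> (real C + 1) * norm (real t ^ s)"
      using eventually_gt_at_top[of 0]
    proof eventually_elim
      case (elim t)
      have "real (f t) \<le> real C * real t ^ s"
        using upper[OF elim] by (metis of_nat_le_iff of_nat_mult of_nat_power)
      then show ?case by (simp add: distrib_right add_increasing2)
    qed
  qed simp
  \<comment> \<open>The maximum with 1 keeps the division by \<open>S\<close> meaningful if
    \<open>s = 0\<close>.\<close>
  define S where "S = max s 1"
  show "(\<lambda>t. real (f t)) \<in> \<Omega>(\<lambda>t. real t ^ s)"
  proof (rule landau_omega.bigI[of "(1 / (2 * real S)) ^ s"])
    show "\<forall>\<^sub>F t in sequentially. (1 / (2 * real S)) ^ s * norm (real t ^ s) \<le> norm (real (f t))"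
      using eventually_ge_at_top[of S]
    proof eventually_elim
      case (elim t)
      define q where "q = t div S"
      have S0: "S > 0" by (simp add: S_def)
      have q: "q \<ge> 1"
        using elim S0 by (simp add: q_def Suc_le_eq div_greater_zero_iff)
      \<comment> \<open>As \<open>q \<ge> 1\<close>, the remainder is at most \<open>q * S\<close>;
        hence \<open>t \<le> 2 * q * S\<close>, the source of the constant.\<close>
      have "t = q * S + t mod S"
        by (simp add: q_def)
      also have "\<dots> \<le> q * S + S"
        using S0 by (simp add: less_imp_le)
      also have "\<dots> \<le> q * S + q * S"
        using q by simp
      finally have "real t \<le> real (q * S + q * S)"
        by (simp only: of_nat_le_iff)
      then have "real t / (2 * real S) \<le> real q"
        using S0 by (simp add: field_simps)
      then have "(real t / (2 * real S)) ^ s \<le> real q ^ s"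
        by (intro power_mono) auto
      moreover have "q * s \<le> q * S"
        by (simp add: S_def)
      then have "q * s \<le> t"
        using div_times_less_eq_dividend[of t S] unfolding q_def by (rule order.trans)
      then have "real q ^ s \<le> real (f t)"
        using lower by (metis of_nat_le_iff of_nat_power)
      ultimately have "(real t / (2 * real S)) ^ s \<le> real (f t)"
        by (rule order.trans)
      then show ?case
        by (simp add: power_divide)
    qed
  qed (simp add: S_def)
qed

section \<open>Reduction of simple families to half-line systems\<close>

theorem theorem4p10:
  fixes scale :: "'d::{division_ring, linordered_ring_strict} \<Rightarrow> 'r::linordered_ab_group_add \<Rightarrow> 'r"
    and one :: 'r
    and I :: "'i set" and m :: "'i \<Rightarrow> nat" and n :: nat
    and V :: "('i \<times> 'r list) set"
    and X :: "'r list \<Rightarrow> ('i \<times> 'r list) set"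
  assumes "ordered_vector_space scale one"
    and "finite I"
    and "V = (SIGMA i:I. tuples (m i))"
    and "infinite V"
    and "family_in V (tuples n) X"
    and "simple_family scale I m n X"
  shows "\<exists>s::nat. (\<lambda>t. real (shatter_function V (tuples n) X t)) \<in> \<Theta>(\<lambda>t. real t ^ s)"
proof -
  interpret ordered_vector_space scale one by fact
  obtain f where f: "\<And>i k. i \<in> I \<Longrightarrow> k < m i \<Longrightarrow> linear_polynomial scale n (f i k)"
      "\<And>i. i \<in> I \<Longrightarrow> family_of_points n (m i) (f i) (\<lambda>b. part (X b) i) \<or>
         family_of_half_lines n (m i) (f i) (\<lambda>b. part (X b) i)"
    using assms(6) unfolding simple_family_def by metis
  \<comment> \<open>Parameters are lists in the family but functions in the locale;
    \<open>map b [0..<n]\<close> translates, and every tuple arises in this way.\<close>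
  have "\<exists>c. \<forall>b. f i k (map b [0..<n]) = eval n c b" if ik: "i \<in> I" "k < m i" for i k
  proof -
    obtain c where c: "\<And>y. y \<in> tuples n \<Longrightarrow> f i k y = (\<Sum>j<n. scale (c j) (y ! j))"
      using f(1)[OF ik] by (auto simp: linear_polynomial_def)
    have "f i k (map b [0..<n]) = eval n c b" for b
      using c[of "map b [0..<n]"] by (simp add: tuples_def eval_def)
    then show ?thesis by blast
  qed
  then obtain c where c: "\<And>i k b. i \<in> I \<Longrightarrow> k < m i \<Longrightarrow> f i k (map b [0..<n]) = eval n (c i k) b"
    by metis
  define pt where "pt = (\<lambda>i. family_of_points n (m i) (f i) (\<lambda>b. part (X b) i))"
  \<comment> \<open>For half-lines the last coordinate serves as the height and is left out of the
    base.\<close>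
  define M where "M = (\<lambda>i. if pt i then m i else m i - 1)"
  define g where "g = (\<lambda>i. if pt i then (\<lambda>_. 0) else c i (m i - 1))"
  define height where "height = (\<lambda>i x. if pt i then 0 else (x::'r list) ! (m i - 1))"
  have half: "m i \<ge> 1" "family_of_half_lines n (m i) (f i) (\<lambda>b. part (X b) i)" if "i \<in> I" "\<not> pt i" for i
    using f(2)[of i] that by (auto simp: pt_def family_of_half_lines_def)
  interpret half_line_system scale one n I M c g "\<lambda>i. tuples (m i)" "\<lambda>i x k. x ! k" height
  proof
    fix i y b assume i: "i \<in> I"
    \<comment> \<open>Only values of the height form have to occur as heights: for points this value
      is 0, and for half-lines the last coordinate can be set freely.\<close>
    show "\<exists>x\<in>tuples (m i). (\<forall>k<M i. x ! k = y k) \<and> height i x = eval n (g i) b"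
    proof (cases "pt i")
      case True
      then show ?thesis
        by (intro bexI[of _ "map y [0..<m i]"]) (auto simp: M_def height_def g_def eval_def tuples_def)
    next
      case False
      then show ?thesis
        using half(1)[OF i False]
        by (intro bexI[of _ "map (y(m i - 1 := eval n (g i) b)) [0..<m i]"])
          (auto simp: M_def height_def tuples_def)
    qed
  qed fact
  have hit_iff: "hit i x b \<longleftrightarrow> (\<forall>k<M i. eval n (c i k) b = x ! k) \<and> eval n (g i) b \<le> height i x" for i x b
    by (simp add: hit_def over_def)
  have X_iff: "(i, x) \<in> X (map b [0..<n]) \<longleftrightarrow> hit i x b" if i: "i \<in> I" "x \<in> tuples (m i)" for i x b
  proof -
    have b: "map b [0..<n] \<in> tuples n" by (simp add: tuples_def)
    have len: "length x = m i" using i(2) by (simp add: tuples_def)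
    have "x \<in> part (X (map b [0..<n])) i \<longleftrightarrow> hit i x b"
    proof (cases "pt i")
      case True
      then have "x \<in> part (X (map b [0..<n])) i \<longleftrightarrow> x = map (\<lambda>k. f i k (map b [0..<n])) [0..<m i]"
        using b by (auto simp: pt_def family_of_points_def)
      also have "\<dots> \<longleftrightarrow> hit i x b"
        using True len c[OF i(1)] unfolding hit_iff
        by (auto simp: M_def g_def height_def list_eq_iff_nth_eq eval_def)
      finally show ?thesis .
    next
      case False
      note m = half[OF i(1) False]
      have "x \<in> part (X (map b [0..<n])) i \<longleftrightarrow>
          (\<exists>u\<ge>f i (m i - 1) (map b [0..<n]). x = map (\<lambda>k. f i k (map b [0..<n])) [0..<m i - 1] @ [u])"
        using m b by (auto simp: family_of_half_lines_def)
      also have "\<dots> \<longleftrightarrow> x ! (m i - 1) \<ge> f i (m i - 1) (map b [0..<n]) \<and>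
          (\<forall>k<m i - 1. x ! k = f i k (map b [0..<n]))"
      proof -
        have "x = map F [0..<m i - 1] @ [u] \<longleftrightarrow> x ! (m i - 1) = u \<and> (\<forall>k<m i - 1. x ! k = F k)" for u F
        proof -
          have "x = take (m i - 1) x @ [x ! (m i - 1)]"
            using len m(1) take_Suc_conv_app_nth[of "m i - 1" x] by simp
          moreover have "take (m i - 1) x = map F [0..<m i - 1] \<longleftrightarrow> (\<forall>k<m i - 1. x ! k = F k)"
            using len by (auto simp: list_eq_iff_nth_eq)
          ultimately show ?thesis
            by (metis append1_eq_conv)
        qed
        then show ?thesis by auto
      qed
      also have "\<dots> \<longleftrightarrow> hit i x b"
        using False m(1) c[OF i(1)] unfolding hit_iff by (auto simp: M_def g_def height_def)
      finally show ?thesis .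
    qed
    then show ?thesis by (simp add: part_def)
  qed
  have tr: "{X b \<inter> A |b. b \<in> tuples n} = range (trace A)" if A: "A \<subseteq> V" for A
  proof -
    have eq: "X (map b [0..<n]) \<inter> A = trace A b" for b
      using A X_iff by (fastforce simp: trace_def assms(3))
    have "(tuples n :: 'r list set) = range (\<lambda>b. map b [0..<n])"
    proof (intro equalityI subsetI)
      fix y :: "'r list" assume "y \<in> tuples n"
      then have "y = map ((!) y) [0..<n]"
        by (auto simp: tuples_def map_nth)
      then show "y \<in> range (\<lambda>b. map b [0..<n])" by blast
    qed (auto simp: tuples_def)
    then have "{X b \<inter> A |b. b \<in> tuples n} = range (\<lambda>b. X (map b [0..<n]) \<inter> A)"
      by auto
    then show ?thesis by (simp add: eq)
  qed
  obtain s where s: "\<And>A. finite A \<Longrightarrow> A \<subseteq> V \<Longrightarrow> A \<noteq> {} \<Longrightarrow> card (range (trace A)) \<le> 8 ^ card I * card A ^ s"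
      "\<And>q. \<exists>A \<subseteq> V. finite A \<and> card A \<le> q * s \<and> q ^ s \<le> card (range (trace A))"
    using exists_trace_exponent unfolding assms(3) by metis
  have "(\<lambda>t. real (shatter_function V (tuples n) X t)) \<in> \<Theta>(\<lambda>t. real t ^ s)"
  proof (rule bigtheta_power_nat)
    \<comment> \<open>At \<open>t = 0\<close> the bound would fail for \<open>s > 0\<close>, since
      the empty set has one trace.\<close>
    show "shatter_function V (tuples n) X t \<le> 8 ^ card I * t ^ s" if "t > 0" for t
    proof (rule shatter_function_le[OF assms(4)])
      fix A assume A: "A \<subseteq> V" "finite A" "card A = t"
      then have "A \<noteq> {}" using that by auto
      then show "card {X b \<inter> A |b. b \<in> tuples n} \<le> 8 ^ card I * t ^ s"
        using s(1)[of A] A by (simp add: tr)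
    qed
    show "q ^ s \<le> shatter_function V (tuples n) X t" if qt: "q * s \<le> t" for q t
    proof -
      obtain A where A: "A \<subseteq> V" "finite A" "card A \<le> q * s" "q ^ s \<le> card (range (trace A))"
        using s(2) by blast
      then have "q ^ s \<le> card {X b \<inter> A |b. b \<in> tuples n}"
        by (simp add: tr)
      also have "\<dots> \<le> shatter_function V (tuples n) X t"
        using A qt by (intro le_shatter_function[OF assms(4)]) auto
      finally show ?thesis .
    qed
  qed
  then show ?thesis ..
qed

end
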